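(* Let $n$ be a positive integer. Suppose that $\alpha^1_1,\dots,\alpha^1_{k_1}\in\overline{\mathbb{D}}$ and $\alpha^2_1,\dots,\alpha^2_{k_2}\in\overline{\mathbb{D}}$, where $k_1+k_2=n$. Suppose that $\sigma_1,\dots,\sigma_n\in\overline{\mathbb{D}}$ are distinct from the points of the set $\{\alpha^i_j: j=1,\dots,k_i,\ i=1,2\}\cap\mathbb{T}$. Then there exists a rational $\overline{\mathbb{E}}$-inner function $x=(x_1,x_2,x_3):\mathbb{D}\to\overline{\mathbb{E}}$ such that (1) the zeros of $x_1$ in $\overline{\mathbb{D}}$, repeated according to multiplicity, are $\alpha^1_1,\dots,\alpha^1_{k_1}$; (2) the zeros of $x_2$ in $\overline{\mathbb{D}}$, repeated according to multiplicity, are $\alpha^2_1,\dots,\alpha^2_{k_2}$; (3) the royal nodes of $x$ are $\sigma_1,\dots,\sigma_n$, with repetition according to the multiplicity of the nodes. Such a function $x$ can be constructed as follows. Let $t_+>0$ and let $t\in\mathbb{C}\setminus\{0\}$. Let $$R(\lambda)=t_+\prod_{j=1}^n(\lambda-\sigma_j)(1-\overline{\sigma_j}\lambda),\qquad E_1(\lambda)=t\prod_{j=1}^{k_1}(\lambda-\alpha^1_j)\prod_{j=1}^{k_2}(1-\overline{\alpha^2_j}\lambda).$$ Then the following statements hold. (i) There exists an outer polynomial $D$ of degree at most $n$ such that $\lambda^{-n}R(\lambda)+|E_1(\lambda)|^2=|D(\lambda)|^2$ for all $\lambda\in\mathbb{T}$. (ii) The function $x$ defined by $$x=\left(\frac{E_1}{D},\frac{E_1^{\sim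 n}}{D},\frac{D^{\sim n}}{D}\right)$$ is a rational $\overline{\mathbb{E}}$-inner function such that the degree of $x$ is equal to $n$ and conditions (1), (2) and (3) hold. The royal polynomial $R_x$ of $x$ is equal to $R$.
   Context: $\mathbb{D}$ is the open unit disc and $\mathbb{T}$ the unit circle in $\mathbb{C}$. The open tetrablock is $\mathbb{E}=\{(x_1,x_2,x_3)\in\mathbb{C}^3: 1-x_1z-x_2w+x_3zw\neq 0 \text{ whenever } |z|\le 1,|w|\le 1\}$, with closure $\overline{\mathbb{E}}$. Its distinguished boundary is $b\overline{\mathbb{E}}=\{x\in\mathbb{C}^3: x_1=\overline{x_2}x_3,\ |x_3|=1,\ |x_2|\le 1\}$. A rational $\overline{\mathbb{E}}$-inner function is a rational analytic map $x=(x_1,x_2,x_3):\mathbb{D}\to\overline{\mathbb{E}}$ (automatically continuous on $\overline{\mathbb{D}}$) that maps $\mathbb{T}$ into $b\overline{\mathbb{E}}$. The degree of $x$ is $x_*(1)$, where $x_*:\mathbb{Z}=\pi_1(\mathbb{T})\to\pi_1(b\overline{\mathbb{E}})\cong\mathbb{Z}$ is induced by $x|_{\mathbb{T}}$ (with sign convention making it non-negative); it equals the degree of the finite Blaschke product $x_3$. For a polynomial $f$ of degree at most $n$, $f^{\sim n}(\lambda)=\lambda^n\overline{f(1/\overline{\lambda})}$. A polynomial is outer if it has no zeros in $\mathbb{D}$. The royal variety is $\mathcal{R}_{\overline{\mathbb{E}}}=\{(x_1,x_2,x_3)\in\mathbb{C}^3:x_1x_2=x_3\}$. For a rational $\overline{\mathbb{E}}$-inner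 function of degree $n$ written as $x=(E_1/D,E_2/D,D^{\sim n}/D)$, with $E_1,E_2,D$ polynomials of degree at most $n$, $E_2=E_1^{\sim n}$ and $D\neq0$ on $\overline{\mathbb{D}}$ (such polynomials exist and are unique up to a common nonzero real factor), the royal polynomial of $x$ is $R_x=D^{\sim n}D-E_1E_2$. Royal nodes of $x$ are the points $\sigma\in\overline{\mathbb{D}}$ with $x(\sigma)\in\mathcal{R}_{\overline{\mathbb{E}}}$, i.e. the zeros of $R_x$ in $\overline{\mathbb{D}}$. If $x(\overline{\mathbb{D}})\not\subseteq\mathcal{R}_{\overline{\mathbb{E}}}$ and $\sigma$ is a zero of $R_x$ of order $\ell$, the multiplicity of $\sigma$ as a royal node is $\#\sigma=\ell$ if $\sigma\in\mathbb{D}$ and $\#\sigma=\ell/2$ if $\sigma\in\mathbb{T}$.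
   Formalization: In (1) and (2), the zeros of x_1 also include the α^2_j lying on T and the zeros of x_2 also include the α^1_j on T, since x_1 and x_2 share their zeros on T; as literally stated, (1) and (2) fail whenever some α^i_j lies on T. *)

theory Defs
  imports
    "HOL-Complex_Analysis.Complex_Analysis"
    "HOL-Computational_Algebra.Polynomial"
    "HOL-Library.Multiset"
begin

section \<open>The tetrablock\<close>

type_synonym c3 = "complex \<times> complex \<times> complex"

definition tetrablock :: "c3 set" where
  "tetrablock = {(x1, x2, x3). \<forall>z w. cmod z \<le> 1 \<longrightarrow> cmod w \<le> 1 \<longrightarrow>
      1 - x1 * z - x2 * w + x3 * z * w \<noteq> 0}"

text \<open>The distinguished boundary of the closed tetrablock.\<close>

definition b_tetrablock :: "c3 set" where
  "b_tetrablock = {(x1, x2, x3). x1 = cnj x2 * x3 \<and> cmod x3 = 1 \<and> cmod x2 \<le> 1}"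

definition royal_variety :: "c3 set" where
  "royal_variety = {(x1, x2, x3). x1 * x2 = x3}"

section \<open>Rational inner functions\<close>

text \<open>A function on the closed disc that is given by a quotient of polynomials; the values of
  \<open>f\<close> outside the closed disc are irrelevant, here and in all definitions below.\<close>

definition rational_on_disc :: "(complex \<Rightarrow> complex) \<Rightarrow> bool" where
  "rational_on_disc f \<longleftrightarrow>
     (\<exists>p q. q \<noteq> 0 \<and> (\<forall>z\<in>cball 0 1. poly q z \<noteq> 0 \<longrightarrow> f z = poly p z / poly q z))"

text \<open>A rational inner function is represented together with its continuous extension to the
  closed disc.\<close>

definition rational_tetra_inner :: "(complex \<Rightarrow> c3) \<Rightarrow> bool" where
  "rational_tetra_inner x \<longleftrightarrow>
     (\<forall>f\<in>{\<lambda>z. fst (x z), \<lambda>z. fst (snd (x z)), \<lambda>z. snd (snd (x z))}.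
        rational_on_disc f \<and> f holomorphic_on ball 0 1 \<and> continuous_on (cball 0 1) f) \<and>
     x ` ball 0 1 \<subseteq> closure tetrablock \<and>
     x ` sphere 0 1 \<subseteq> b_tetrablock"

text \<open>The degree \<open>x\<^sub>*(1)\<close>, where the fundamental group of \<^const>\<open>b_tetrablock\<close> is identified with
  the integers by taking the class of the loop \<open>\<lambda>t. (0, 0, cis (2 * pi * t))\<close> as generator
  (this choice makes the degree of an inner function non-negative).  As this group is abelian,
  free homotopy of loops suffices.\<close>

definition tetra_degree :: "(complex \<Rightarrow> c3) \<Rightarrow> int" where
  "tetra_degree x = (THE k. homotopic_loops b_tetrablock
      (\<lambda>t. x (cis (2 * pi * t))) (\<lambda>t. (0, 0, cis (2 * pi * of_int k * t))))"

section \<open>Polynomials\<close>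

text \<open>\<open>conj_reflect n f\<close> is the polynomial \<open>f\<^sup>\<sim>\<^sup>n\<close>, see the lemma.\<close>

definition conj_reflect :: "nat \<Rightarrow> complex poly \<Rightarrow> complex poly" where
  "conj_reflect n f = (\<Sum>k\<le>n. monom (cnj (coeff f (n - k))) k)"

lemma poly_conj_reflect:
  assumes "degree f \<le> n" "z \<noteq> 0"
  shows "poly (conj_reflect n f) z = z ^ n * cnj (poly f (1 / cnj z))"
proof -
  have "poly f (1 / cnj z) = (\<Sum>k\<le>n. coeff f k * (1 / cnj z) ^ k)"
    unfolding poly_altdef
    by (rule sum.mono_neutral_left) (use assms(1) in \<open>auto simp: coeff_eq_0\<close>)
  then have "z ^ n * cnj (poly f (1 / cnj z)) = (\<Sum>k\<le>n. cnj (coeff f k) * z ^ (n - k))"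
    using assms(2)
    by (auto simp: sum_distrib_left power_diff power_one_over intro!: sum.cong)
  also have "\<dots> = (\<Sum>k\<le>n. cnj (coeff f (n - k)) * z ^ k)"
    by (rule sum.reindex_bij_witness[where i = "\<lambda>k. n - k" and j = "\<lambda>k. n - k"]) auto
  finally show ?thesis
    by (simp add: conj_reflect_def poly_sum poly_monom)
qed

definition outer_poly :: "complex poly \<Rightarrow> bool" where
  "outer_poly f \<longleftrightarrow> (\<forall>z\<in>ball 0 1. poly f z \<noteq> 0)"

section \<open>Zeros, royal polynomial and royal nodes\<close>

text \<open>The family \<open>a 1, \<dots>, a k\<close> with repetitions.\<close>

definition family :: "nat \<Rightarrow> (nat \<Rightarrow> complex) \<Rightarrow> complex multiset" where
  "family k a = image_mset a (mset_set {1..k})"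

text \<open>\<open>M\<close> is the multiset of zeros in the closed disc of the rational function \<open>f\<close>, which has no
  poles there and is not identically zero.  The order of a zero is independent of the choice of
  \<open>p\<close> and \<open>q\<close>.\<close>

definition zeros_in_cdisc :: "(complex \<Rightarrow> complex) \<Rightarrow> complex multiset \<Rightarrow> bool" where
  "zeros_in_cdisc f M \<longleftrightarrow> set_mset M \<subseteq> cball 0 1 \<and>
     (\<exists>p q. p \<noteq> 0 \<and> (\<forall>z\<in>cball 0 1. poly q z \<noteq> 0 \<and> f z = poly p z / poly q z) \<and>
        (\<forall>z\<in>cball 0 1. count M z = order z p))"

definition tetra_representation ::
    "nat \<Rightarrow> (complex \<Rightarrow> c3) \<Rightarrow> complex poly \<Rightarrow> complex poly \<Rightarrow> complex poly \<Rightarrow> bool" where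
  "tetra_representation n x E1 E2 D \<longleftrightarrow>
     degree E1 \<le> n \<and> degree E2 \<le> n \<and> degree D \<le> n \<and> E2 = conj_reflect n E1 \<and>
     (\<forall>z\<in>cball 0 1. poly D z \<noteq> 0 \<and>
        x z = (poly E1 z / poly D z, poly E2 z / poly D z, poly (conj_reflect n D) z / poly D z))"

text \<open>A relation, because the royal polynomial is only determined up to a positive factor.\<close>

definition royal_polynomial :: "(complex \<Rightarrow> c3) \<Rightarrow> complex poly \<Rightarrow> bool" where
  "royal_polynomial x R \<longleftrightarrow> (\<exists>n E1 E2 D. tetra_degree x = int n \<and>
     tetra_representation n x E1 E2 D \<and> R = conj_reflect n D * D - E1 * E2)"

definition royal_multiplicity :: "complex poly \<Rightarrow> complex \<Rightarrow> real" where
  "royal_multiplicity R \<sigma> = (if cmod \<sigma> < 1 then real (order \<sigma> R) else real (order \<sigma> R) / 2)"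

text \<open>The nodes are the points of the closed disc mapped into the royal variety; their
  multiplicities come from any royal polynomial, since a constant factor does not matter.\<close>

definition royal_nodes :: "(complex \<Rightarrow> c3) \<Rightarrow> complex multiset \<Rightarrow> bool" where
  "royal_nodes x M \<longleftrightarrow> \<not> x ` cball 0 1 \<subseteq> royal_variety \<and>
     set_mset M = {\<sigma>\<in>cball 0 1. x \<sigma> \<in> royal_variety} \<and>
     (\<exists>R. royal_polynomial x R \<and>
        (\<forall>\<sigma>\<in>cball 0 1. real (count M \<sigma>) = royal_multiplicity R \<sigma>))"

text \<open>The multiset of zeros in the closed disc of one of the first two components of an inner
  function, where \<open>A\<close> is the family prescribed for this component and \<open>B\<close> the family prescribed
  for the other one.  Since \<open>x1 = cnj x2 * x3\<close> and \<open>cmod x3 = 1\<close> on the circle, the first two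
  components have the same zeros on the circle, with the same orders.  Hence the two families
  together list each of these common zeros as often as its order, whichever of them it is put in,
  and the points of \<open>B\<close> on the circle are zeros of the component at hand as well.  If \<open>B\<close> lies
  in the open disc, this is just \<open>A\<close>.\<close>

definition component_zeros :: "complex multiset \<Rightarrow> complex multiset \<Rightarrow> complex multiset" where
  "component_zeros A B = A + filter_mset (\<lambda>z. cmod z = 1) B"

end

theory Submission
  imports Defs "HOL-Computational_Algebra.Fundamental_Theorem_Algebra"
begin

text \<open>
  On the unit circle \<open>(z - a) * (1 - cnj a * z) = z * \<bar>z - a\<bar>\<^sup>2\<close>, so \<open>z\<^sup>-\<^sup>n R\<close> is \<open>t_plus\<close> times the
  product of the \<open>\<bar>z - \<sigma> j\<bar>\<^sup>2\<close>.  It is nonnegative and vanishes exactly at the nodes on the circle,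
  which by hypothesis are no zeros of \<open>E1\<close>.  Hence \<open>z\<^sup>-\<^sup>n R + \<bar>E1\<bar>\<^sup>2\<close> is a strictly positive trigonometric
  polynomial, and a Fejer--Riesz factorization (\<open>fejer_riesz_positive\<close>) gives an outer \<open>D\<close> with
  this squared modulus on the circle.

  Let \<open>D\<close> be any such polynomial.  It has no zeros in the closed disc, and \<open>\<bar>E1\<bar> \<le> \<bar>D\<bar>\<close> on the circle.
  As \<open>f\<^sup>\<sim> = z\<^sup>n * cnj f\<close> there, the spectral equation is the polynomial identity
  \<open>D\<^sup>\<sim> * D - E1 * E1\<^sup>\<sim> = R\<close>, both sides agreeing at infinitely many points: \<open>R\<close> is the royal
  polynomial.  The same formula shows that \<open>x = (E1 / D, E1\<^sup>\<sim> / D, D\<^sup>\<sim> / D)\<close> maps the circle into the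
  distinguished boundary.

  That \<open>x\<close> maps the disc into the closed tetrablock is an application of the maximum principle:
  for fixed \<open>w\<close> in the open disc, \<open>(x1 - x3 * w) / (1 - x2 * w)\<close> is holomorphic and bounded by \<open>1\<close> on
  the circle, hence everywhere (\<open>quotient_bound\<close>); therefore \<open>1 - x1 * z - x2 * w + x3 * z * w\<close> has no
  zeros in the open bidisc (\<open>tetra_map_closure\<close>).

  The degree is found by deforming \<open>D\<close> to a constant through \<open>D (r * z)\<close>, which leaves the loop \<open>z\<^sup>n\<close>
  times a unimodular constant in the third coordinate (\<open>homotopic_tetra_map\<close>).  The zeros and the nodes are then read off from
  the linear factors.  A factor \<open>1 - cnj a * z\<close> with \<open>a \<noteq> 0\<close> vanishes at \<open>1 / cnj a\<close>, which lies in the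
  closed disc only if \<open>\<bar>a\<bar> = 1\<close>, and then it is \<open>a\<close> itself; this is why the order of a node on the circle is
  halved and why the two families of zeros mix on the circle.
\<close>

section \<open>Polynomials on the unit circle\<close>

lemma infinite_unit_circle: "infinite (sphere (0::complex) 1)"
proof
  assume "finite (sphere (0::complex) 1)"
  then obtain a where a: "sphere (0::complex) 1 \<subseteq> {a}"
    using connected_finite_iff_sing[OF connected_sphere[of "0::complex" 1]] by auto
  have "(1::complex) \<in> sphere 0 1" "(-1::complex) \<in> sphere 0 1"
    by auto
  with a have "(1::complex) = -1"
    by blast
  then show False
    by simp
qed

lemma poly_eqI_circle:
  fixes p q :: "complex poly"
  assumes "\<And>z. cmod z = 1 \<Longrightarrow> poly p z = poly q z"
  shows "p = q"
proof (rule ccontr)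
  assume "p \<noteq> q"
  then have "finite {z. poly (p - q) z = 0}"
    by (intro poly_roots_finite) auto
  moreover have "sphere 0 1 \<subseteq> {z. poly (p - q) z = 0}"
    using assms by auto
  ultimately show False
    using infinite_unit_circle finite_subset by blast
qed

lemma inverse_cnj_on_circle: "cmod z = 1 \<Longrightarrow> 1 / cnj z = z"
  by (metis complex_norm_square divide_eq_eq mult.commute norm_zero of_real_1 one_power2
      complex_cnj_zero_iff zero_neq_one)

lemma poly_conj_reflect_circle:
  assumes "degree f \<le> n" "cmod z = 1"
  shows "poly (conj_reflect n f) z = z ^ n * cnj (poly f z)"
  using poly_conj_reflect[of f n z] assms inverse_cnj_on_circle[of z] by fastforce

lemma degree_conj_reflect: "degree (conj_reflect n f) \<le> n"
  unfolding conj_reflect_def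
  by (intro degree_sum_le) (auto intro: order_trans[OF degree_monom_le])

lemma reflected_factor_on_circle:
  assumes "cmod z = 1"
  shows "1 - cnj a * z = z * cnj (z - a)" "z - a = z * cnj (1 - cnj a * z)"
proof -
  have "z * cnj z = 1"
    using assms by (simp add: complex_norm_square[symmetric])
  then show "1 - cnj a * z = z * cnj (z - a)" "z - a = z * cnj (1 - cnj a * z)"
    by (auto simp: algebra_simps)
qed

text \<open>Reflection interchanges the factors \<open>z - a\<close> and \<open>1 - cnj a * z\<close>, so that it exchanges the roles
  of the two families of zeros.\<close>

lemma conj_reflect_prod_linear:
  fixes a b :: "nat \<Rightarrow> complex"
  shows "conj_reflect (k + l)
      (smult t ((\<Prod>j=1..k. [:- a j, 1:]) * (\<Prod>j=1..l. [:1, - cnj (b j):])))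
    = smult (cnj t) ((\<Prod>j=1..l. [:- b j, 1:]) * (\<Prod>j=1..k. [:1, - cnj (a j):]))"
    (is "conj_reflect _ ?f = ?g")
    and degree_prod_linear: "degree
      (smult t ((\<Prod>j=1..k. [:- a j, 1:]) * (\<Prod>j=1..l. [:1, - cnj (b j):]))) \<le> k + l"
proof -
  have "degree (\<Prod>j=1..k. [:- a j, 1:]) \<le> k"
    by (rule order_trans[OF degree_prod_sum_le]) auto
  moreover have "degree (\<Prod>j=1..l. [:1, - cnj (b j):]) \<le> l"
    by (rule order_trans[OF degree_prod_sum_le])
      (auto intro!: order_trans[OF sum_bounded_above[where K = 1]])
  ultimately show deg: "degree ?f \<le> k + l"
    by (intro order_trans[OF degree_smult_le] order_trans[OF degree_mult_le] add_mono)
  show "conj_reflect (k + l) ?f = ?g"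
  proof (rule poly_eqI_circle)
    fix z :: complex assume z: "cmod z = 1"
    have "(\<Prod>j=1..l. z - b j) = (\<Prod>j=1..l. z * cnj (1 - cnj (b j) * z))"
      using reflected_factor_on_circle(2)[OF z] by (intro prod.cong) auto
    moreover have "(\<Prod>j=1..k. 1 - cnj (a j) * z) = (\<Prod>j=1..k. z * cnj (z - a j))"
      using reflected_factor_on_circle(1)[OF z] by (intro prod.cong) auto
    ultimately show "poly (conj_reflect (k + l) ?f) z = poly ?g z"
      unfolding poly_conj_reflect_circle[OF deg z]
      by (simp add: poly_prod prod.distrib power_add algebra_simps del: complex_cnj_diff)
  qed
qed

section \<open>Spectral factorization\<close>

lemma poly_no_nonzero_root:
  fixes p :: "complex poly"
  assumes "p \<noteq> 0" "\<And>z. z \<noteq> 0 \<Longrightarrow> poly p z \<noteq> 0"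
  shows "\<exists>c m. p = monom c m"
proof -
  obtain q where q: "p = [:- 0, 1:] ^ order 0 p * q" "\<not> [:- 0, 1:] dvd q"
    using order_decomp[OF assms(1)] by blast
  have "poly q z \<noteq> 0" for z
  proof (cases "z = 0")
    case True
    then show ?thesis
      using q(2) by (simp only: dvd_iff_poly_eq_0 minus_zero not_False_eq_True simp_thms)
  next
    case False
    then have "poly p z \<noteq> 0"
      by (rule assms(2))
    then show ?thesis
      using arg_cong[OF q(1), of "\<lambda>p. poly p z"] by auto
  qed
  then obtain c where "q = [:c:]"
    using fundamental_theorem_of_algebra_alt[of q] by blast
  then have "p = monom c (order 0 p)"
    using q(1) by (simp add: monom_altdef mult.commute)
  then show ?thesis
    by blast
qed

text \<open>This is the strictly positive case of the theorem of Fejer and Riesz: a trigonometric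
  polynomial \<open>P(z) / z\<^sup>n\<close> that is positive on the circle is the squared modulus of an outer
  polynomial.  Being real on the circle, it has its zeros in pairs \<open>w\<close>, \<open>1 / cnj w\<close>, one of them
  outside the closed disc; since \<open>(z - w) * (1 - cnj w * z) = z * \<bar>z - w\<bar>\<^sup>2\<close> on the circle, such a
  pair can be split off and contributes the factor \<open>z - w\<close>.\<close>

lemma fejer_riesz_positive:
  fixes P :: "complex poly"
  assumes "degree P \<le> 2 * n"
    and "\<And>z. cmod z = 1 \<Longrightarrow> \<exists>r>0. poly P z = of_real r * z ^ n"
  shows "\<exists>D. degree D \<le> n \<and> outer_poly D \<and>
    (\<forall>z. cmod z = 1 \<longrightarrow> poly P z = of_real ((cmod (poly D z))\<^sup>2) * z ^ n)"
  using assms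
proof (induction n arbitrary: P rule: less_induct)
  case (less n)
  have nz: "poly P z \<noteq> 0" if "cmod z = 1" for z
    using less.prems(2)[OF that] that by auto
  then have "P \<noteq> 0"
    using norm_one by (metis poly_0)
  show ?case
  proof (cases "\<exists>w. w \<noteq> 0 \<and> poly P w = 0")
    case False
    then obtain c m where P: "P = monom c m"
      using poly_no_nonzero_root[OF \<open>P \<noteq> 0\<close>] by blast
    obtain r where r: "r > 0" "c = of_real r"
      using less.prems(2)[of 1] by (auto simp: P poly_monom)
    \<comment> \<open>\<open>c * z\<^sup>m / z\<^sup>n\<close> is positive and of constant modulus on the circle, hence constant\<close>
    have "P = monom c n"
    proof (rule poly_eqI_circle)
      fix z :: complex assume z: "cmod z = 1"
      obtain s where s: "s > 0" "c * z ^ m = of_real s * z ^ n"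
        using less.prems(2)[OF z] by (auto simp: P poly_monom)
      have "r = s"
        using arg_cong[OF s(2), of cmod] r s(1) z by (simp add: norm_mult norm_power)
      then show "poly P z = poly (monom c n) z"
        using s r by (simp add: P poly_monom)
    qed
    then show ?thesis
      using r by (intro exI[of _ "[:of_real (sqrt r):]"]) (auto simp: outer_poly_def poly_monom)
  next
    case True
    have reflect: "conj_reflect (2 * n) P = P"
    proof (rule poly_eqI_circle)
      fix z :: complex assume z: "cmod z = 1"
      obtain r where "poly P z = of_real r * z ^ n"
        using less.prems(2)[OF z] by blast
      moreover have "z * cnj z = 1"
        using z by (simp add: complex_norm_square[symmetric])
      then have "z ^ n * cnj z ^ n = 1"
        by (metis power_mult_distrib power_one)
      ultimately show "poly (conj_reflect (2 * n) P) z = poly P z"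
        unfolding poly_conj_reflect_circle[OF less.prems(1) z]
        by (simp add: mult_2 power_add)
    qed
    have root_reflect: "poly P (1 / cnj w) = 0" if "w \<noteq> 0" "poly P w = 0" for w
      using poly_conj_reflect[OF less.prems(1) that(1)] reflect that by simp
    obtain w0 where w0: "w0 \<noteq> 0" "poly P w0 = 0"
      using True by blast
    \<comment> \<open>of \<open>w0\<close> and its mirror image, the one outside the closed disc: this makes \<open>D\<close> outer\<close>
    obtain w where w: "cmod w > 1" "poly P w = 0"
    proof (cases "cmod w0 > 1")
      case False
      then have "cmod w0 < 1"
        using nz w0 by force
      then have "cmod (1 / cnj w0) > 1"
        using w0 by (simp add: norm_divide)
      then show ?thesis
        using that root_reflect w0 by blast
    qed (use that w0 in blast)
    then have [simp]: "w \<noteq> 0"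
      by auto
    obtain Q1 where Q1: "P = [:- w, 1:] * Q1"
      using w(2) by (auto simp: poly_eq_0_iff_dvd elim: dvdE)
    have "1 / cnj w \<noteq> w"
    proof
      assume "1 / cnj w = w"
      then have "cmod w * cmod w = 1"
        by (metis \<open>w \<noteq> 0\<close> complex_cnj_zero_iff complex_mod_cnj divide_eq_eq norm_mult norm_one)
      then show False
        using w(1) mult_strict_mono[of 1 "cmod w" 1 "cmod w"] by simp
    qed
    then have "poly Q1 (1 / cnj w) = 0"
      using root_reflect[OF \<open>w \<noteq> 0\<close> w(2)] unfolding Q1
      by (auto simp: add_eq_0_iff simp del: mult_pCons_left)
    then obtain Q2 where Q2: "Q1 = [:- (1 / cnj w), 1:] * Q2"
      by (auto simp: poly_eq_0_iff_dvd elim: dvdE)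
    define Q where "Q = smult (- 1 / cnj w) Q2"
    have P: "P = [:- w, 1:] * [:1, - cnj w:] * Q"
      by (rule poly_eqI_circle) (simp add: Q1 Q2 Q_def field_simps)
    then have "Q \<noteq> 0"
      using \<open>P \<noteq> 0\<close> by auto
    then have "degree P = degree Q + 2"
      unfolding P by (subst degree_mult_eq, (simp; fail)+)+
    then obtain m where n: "n = Suc m" and "degree Q \<le> 2 * m"
      using less.prems(1) by (cases n) auto
    have pos: "\<exists>r>0. poly Q z = of_real r * z ^ m" if z: "cmod z = 1" for z
    proof -
      obtain r where r: "r > 0" "poly P z = of_real r * z ^ n"
        using less.prems(2)[OF z] by blast
      have "z - w \<noteq> 0" "z \<noteq> 0"
        using z w(1) by auto
      have "of_real r * z ^ m * z = (z - w) * (1 - cnj w * z) * poly Q z"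
        using r(2) by (simp add: P n algebra_simps)
      also have "\<dots> = of_real ((cmod (z - w))\<^sup>2) * poly Q z * z"
        unfolding reflected_factor_on_circle(1)[OF z] complex_norm_square by simp
      finally have "poly Q z = of_real (r / (cmod (z - w))\<^sup>2) * z ^ m"
        using \<open>z - w \<noteq> 0\<close> \<open>z \<noteq> 0\<close> by (simp add: field_simps)
      then show ?thesis
        using r(1) \<open>z - w \<noteq> 0\<close> by (intro exI[of _ "r / (cmod (z - w))\<^sup>2"]) auto
    qed
    obtain D where D: "degree D \<le> m" "outer_poly D"
      "\<And>z. cmod z = 1 \<Longrightarrow> poly Q z = of_real ((cmod (poly D z))\<^sup>2) * z ^ m"
      using less.IH[OF _ \<open>degree Q \<le> 2 * m\<close> pos] n by auto
    show ?thesis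
    proof (intro exI[of _ "[:- w, 1:] * D"] conjI allI impI)
      show "degree ([:- w, 1:] * D) \<le> n"
        using D(1) n by (intro order_trans[OF degree_mult_le]) auto
      show "outer_poly ([:- w, 1:] * D)"
        using D(2) w(1) by (auto simp: outer_poly_def)
      fix z :: complex assume z: "cmod z = 1"
      have "poly P z = (z - w) * (1 - cnj w * z) * poly Q z"
        by (simp add: P algebra_simps)
      also have "\<dots> = of_real ((cmod (z - w))\<^sup>2) * poly Q z * z"
        unfolding reflected_factor_on_circle(1)[OF z] complex_norm_square by simp
      finally show "poly P z = of_real ((cmod (poly ([:- w, 1:] * D) z))\<^sup>2) * z ^ n"
        by (simp add: D(3)[OF z] n norm_mult power_mult_distrib del: mult_pCons_left)
    qed
  qed
qed

section \<open>Orders of zeros of products of linear factors\<close>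

lemma order_prod_sum:
  fixes f :: "'a \<Rightarrow> 'b::idom poly"
  assumes "finite A" "\<And>j. j \<in> A \<Longrightarrow> f j \<noteq> 0"
  shows "order z (prod f A) = (\<Sum>j\<in>A. order z (f j))"
  using assms by (induction A rule: finite_induct) (auto simp: order_mult)

lemma order_linear_factor: "order z [:- a, 1:] = of_bool (a = (z::complex))"
  using order_power_n_n[of z 1] by (auto intro: order_0I)

text \<open>The zero \<open>1 / cnj a\<close> is the mirror image of \<open>a\<close> in the circle, so the two coincide or the zero
  is outside the closed disc.\<close>

lemma order_reflected_linear_factor:
  assumes "cmod a \<le> 1" "cmod z \<le> 1"
  shows "order z [:1, - cnj a:] = of_bool (a = z \<and> cmod z = 1)"
proof (cases "cnj a * z = 1")
  case True
  have "cmod a * cmod z = 1"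
    using arg_cong[OF True, of cmod] by (simp add: norm_mult)
  then have "cmod z = 1"
    using assms mult_right_mono[of "cmod a" 1 "cmod z"] by simp
  then have "a = z"
    using reflected_factor_on_circle(1)[OF \<open>cmod z = 1\<close>, of a] True \<open>cmod z = 1\<close> by auto
  then have "[:1, - cnj a:] = smult (- cnj a) [:- a, 1:]"
    using True \<open>a = z\<close> by simp
  moreover have "cnj a \<noteq> 0"
    using True by auto
  ultimately show ?thesis
    using order_linear_factor[of z a] \<open>cmod z = 1\<close> by (simp add: order_smult del: smult_pCons)
next
  case False
  have "\<not> (a = z \<and> cmod z = 1)"
    using False by (auto simp: complex_norm_square[symmetric] mult.commute)
  then show ?thesis
    using False by (auto intro!: order_0I simp: mult.commute)
qed

lemma count_family: "count (family k a) z = (\<Sum>j=1..k. of_bool (a j = z))"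
proof -
  have "count (image_mset a (mset_set A)) z = (\<Sum>j\<in>A. of_bool (a j = z))" if "finite A" for A
    using that by (induction A rule: finite_induct) auto
  then show ?thesis
    by (simp add: family_def)
qed

lemma set_mset_family: "set_mset (family k a) = a ` {1..k}"
  by (simp add: family_def)

lemma order_prod_linear:
  assumes "\<And>j. j \<in> {1..k} \<Longrightarrow> cmod (a j) \<le> 1" "\<And>j. j \<in> {1..l} \<Longrightarrow> cmod (b j) \<le> 1"
    and "cmod z \<le> 1" "t \<noteq> 0"
  shows "order z (smult t ((\<Prod>j=1..k. [:- a j, 1:]) * (\<Prod>j=1..l. [:1, - cnj (b j):])))
    = count (component_zeros (family k a) (family l b)) z"
proof -
  have "order z (\<Prod>j=1..k. [:- a j, 1:]) = count (family k a) z"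
    by (simp add: order_prod_sum order_linear_factor count_family)
  moreover have "order z (\<Prod>j=1..l. [:1, - cnj (b j):])
      = count (filter_mset (\<lambda>z. cmod z = 1) (family l b)) z"
    using assms(2,3)
    by (simp add: order_prod_sum order_reflected_linear_factor count_family)
  moreover have "(\<Prod>j=1..k. [:- a j, 1:]) * (\<Prod>j=1..l. [:1, - cnj (b j):]) \<noteq> 0"
    by simp
  ultimately show ?thesis
    using assms(4) by (simp add: order_mult order_smult component_zeros_def del: mult_eq_0_iff)
qed

lemma set_component_zeros:
  assumes "\<And>j. j \<in> {1..k} \<Longrightarrow> cmod (a j) \<le> 1" "\<And>j. j \<in> {1..l} \<Longrightarrow> cmod (b j) \<le> 1"
  shows "set_mset (component_zeros (family k a) (family l b)) \<subseteq> cball 0 1"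
  using assms by (auto simp: component_zeros_def set_mset_family)

text \<open>A node on the circle is a zero of both of its factors.\<close>

lemma order_royal:
  assumes "\<And>j. j \<in> {1..n} \<Longrightarrow> cmod (s j) \<le> 1" "cmod z \<le> 1" "t \<noteq> 0"
  shows "order z (smult t (\<Prod>j=1..n. [:- s j, 1:] * [:1, - cnj (s j):]))
    = (if cmod z = 1 then 2 else 1) * count (family n s) z"
proof -
  have "order z (smult t (\<Prod>j=1..n. [:- s j, 1:] * [:1, - cnj (s j):]))
    = count (component_zeros (family n s) (family n s)) z"
    unfolding prod.distrib using assms by (intro order_prod_linear)
  then show ?thesis
    by (simp add: component_zeros_def)
qed


section \<open>The rational inner function with given numerator and denominator\<close>

lemma disc_max_modulus:
  assumes "f holomorphic_on ball 0 1" "continuous_on (cball 0 1) f"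
    and "\<And>z. cmod z = 1 \<Longrightarrow> cmod (f z) \<le> B" "cmod z \<le> 1"
  shows "cmod (f z) \<le> B"
  by (rule maximum_modulus_frontier[of f "cball 0 1"]) (use assms in auto)

text \<open>These conditions make \<open>(E / D, E\<^sup>\<sim> / D, D\<^sup>\<sim> / D)\<close> inner.  The identity \<open>x1 = cnj x2 * x3\<close> on the
  circle comes from the shape of the triple, the bound \<open>\<bar>x2\<bar> \<le> 1\<close> from \<open>\<bar>E\<bar> \<le> \<bar>D\<bar>\<close>.\<close>

locale tetra_data =
  fixes n :: nat and E D :: "complex poly"
  assumes degree_E: "degree E \<le> n" and degree_D: "degree D \<le> n"
    and D_nonzero: "cmod z \<le> 1 \<Longrightarrow> poly D z \<noteq> 0"
    and E_le_D: "cmod z = 1 \<Longrightarrow> cmod (poly E z) \<le> cmod (poly D z)"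
begin

definition x1 :: "complex \<Rightarrow> complex" where
  "x1 z = poly E z / poly D z"

definition x2 :: "complex \<Rightarrow> complex" where
  "x2 z = poly (conj_reflect n E) z / poly D z"

definition x3 :: "complex \<Rightarrow> complex" where
  "x3 z = poly (conj_reflect n D) z / poly D z"

definition tetra_map :: "complex \<Rightarrow> c3" where
  "tetra_map z = (x1 z, x2 z, x3 z)"

lemmas component_defs = x1_def x2_def x3_def

lemma holomorphic_components:
  "x1 holomorphic_on ball 0 1" "x2 holomorphic_on ball 0 1" "x3 holomorphic_on ball 0 1"
  unfolding component_defs[abs_def] using D_nonzero by (auto intro!: holomorphic_intros)

lemma continuous_components:
  "continuous_on (cball 0 1) x1" "continuous_on (cball 0 1) x2" "continuous_on (cball 0 1) x3"
  unfolding component_defs[abs_def] using D_nonzero by (auto intro!: continuous_intros)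

lemma rational_components:
  "rational_on_disc x1" "rational_on_disc x2" "rational_on_disc x3"
proof -
  have "D \<noteq> 0"
    using D_nonzero[of 0] by auto
  then show "rational_on_disc x1" "rational_on_disc x2" "rational_on_disc x3"
    unfolding rational_on_disc_def component_defs by blast+
qed

lemma x2_circle:
  assumes "cmod z = 1"
  shows "x2 z = z ^ n * cnj (poly E z) / poly D z"
  using poly_conj_reflect_circle[OF degree_E assms] by (simp add: x2_def)

lemma x3_circle:
  assumes "cmod z = 1"
  shows "x3 z = z ^ n * cnj (poly D z) / poly D z"
  using poly_conj_reflect_circle[OF degree_D assms] by (simp add: x3_def)

lemma norm_x2_circle: "cmod z = 1 \<Longrightarrow> cmod (x2 z) \<le> 1"
  using D_nonzero[of z] E_le_D[of z]
  by (simp add: x2_circle norm_mult norm_divide norm_power divide_le_eq)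

lemma norm_x3_circle: "cmod z = 1 \<Longrightarrow> cmod (x3 z) = 1"
  using D_nonzero[of z] by (simp add: x3_circle norm_mult norm_divide norm_power)

lemma x1_eq_circle:
  assumes "cmod z = 1"
  shows "x1 z = cnj (x2 z) * x3 z"
proof -
  have "z * cnj z = 1"
    using assms by (simp add: complex_norm_square[symmetric])
  then have "z ^ n * cnj z ^ n = 1"
    by (metis power_mult_distrib power_one)
  then show ?thesis
    using D_nonzero[of z] assms
    by (simp add: x2_circle[OF assms] x3_circle[OF assms] x1_def field_simps)
qed

lemma tetra_map_circle: "cmod z = 1 \<Longrightarrow> tetra_map z \<in> b_tetrablock"
  using x1_eq_circle norm_x3_circle norm_x2_circle by (simp add: tetra_map_def b_tetrablock_def)

lemma norm_x2: "cmod z \<le> 1 \<Longrightarrow> cmod (x2 z) \<le> 1"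
  using disc_max_modulus[OF holomorphic_components(2) continuous_components(2) norm_x2_circle] .

text \<open>For fixed \<open>w\<close> in the open disc, the quotient is holomorphic in the disc, since
  \<open>\<bar>x2\<bar> \<le> 1\<close>, so it suffices to bound it on the circle.  There \<open>x1 - x3 * w = x3 * cnj (x2 - cnj w)\<close>
  and \<open>\<bar>x3\<bar> = 1\<close>, so its modulus is that of the Moebius map of the disc with zero \<open>cnj w\<close>, at
  \<open>x2\<close>.\<close>

lemma quotient_bound:
  assumes w: "cmod w < 1" and z: "cmod z \<le> 1"
  shows "1 - x2 z * w \<noteq> 0" "cmod ((x1 z - x3 z * w) / (1 - x2 z * w)) \<le> 1"
proof -
  have nz: "1 - x2 z * w \<noteq> 0" if "cmod z \<le> 1" for z
  proof
    assume "1 - x2 z * w = 0"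
    then have "cmod (x2 z) * cmod w = 1"
      by (metis norm_mult norm_one right_minus_eq)
    then show False
      using norm_x2[OF that] w mult_right_mono[of "cmod (x2 z)" 1 "cmod w"] by simp
  qed
  show "1 - x2 z * w \<noteq> 0"
    using nz z .
  show "cmod ((x1 z - x3 z * w) / (1 - x2 z * w)) \<le> 1"
  proof (rule disc_max_modulus[OF _ _ _ z])
    show "(\<lambda>z. (x1 z - x3 z * w) / (1 - x2 z * w)) holomorphic_on ball 0 1"
      using nz by (auto intro!: holomorphic_intros holomorphic_components)
    show "continuous_on (cball 0 1) (\<lambda>z. (x1 z - x3 z * w) / (1 - x2 z * w))"
      using nz by (auto intro!: continuous_intros continuous_components)
    fix z :: complex assume z: "cmod z = 1"
    have "x1 z - x3 z * w = x3 z * cnj (x2 z - cnj w)"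
      using x1_eq_circle[OF z] by (simp add: algebra_simps)
    then have num: "cmod (x1 z - x3 z * w) = cmod (x2 z - cnj w)"
      using norm_x3_circle[OF z] by (simp only: norm_mult complex_mod_cnj mult_1)
    \<comment> \<open>the identity behind the Schwarz--Pick lemma\<close>
    have "of_real ((cmod (1 - x2 z * w))\<^sup>2 - (cmod (x2 z - cnj w))\<^sup>2)
        = (of_real ((1 - (cmod (x2 z))\<^sup>2) * (1 - (cmod w)\<^sup>2)) :: complex)"
      unfolding of_real_diff of_real_mult of_real_1 complex_norm_square
      by (simp add: algebra_simps)
    then have "(cmod (1 - x2 z * w))\<^sup>2 - (cmod (x2 z - cnj w))\<^sup>2
        = (1 - (cmod (x2 z))\<^sup>2) * (1 - (cmod w)\<^sup>2)"
      using of_real_eq_iff by blast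
    moreover have "(1 - (cmod (x2 z))\<^sup>2) * (1 - (cmod w)\<^sup>2) \<ge> 0"
      using norm_x2_circle[OF z] w by (intro mult_nonneg_nonneg) (auto simp: power_le_one)
    ultimately have "(cmod (x2 z - cnj w))\<^sup>2 \<le> (cmod (1 - x2 z * w))\<^sup>2"
      by linarith
    then have "cmod (x2 z - cnj w) \<le> cmod (1 - x2 z * w)"
      by (rule power2_le_imp_le) simp
    then show "cmod ((x1 z - x3 z * w) / (1 - x2 z * w)) \<le> 1"
      using nz[of z] z by (simp add: num norm_divide divide_le_eq)
  qed
qed

text \<open>The bound shows that \<open>1 - x1 * z - x2 * w + x3 * z * w\<close>, which equals
  \<open>(1 - x2 * w) - z * (x1 - x3 * w)\<close>, has no zeros in the open bidisc.  Shrinking the point to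
  \<open>(r * x1, r * x2, r\<^sup>2 * x3)\<close> with \<open>r < 1\<close> rescales \<open>z\<close> and \<open>w\<close> by \<open>r\<close>, so that it has none in the
  closed bidisc either.\<close>

lemma tetra_map_closure:
  assumes "cmod a \<le> 1"
  shows "tetra_map a \<in> closure tetrablock"
proof -
  have open_bidisc: "1 - x1 a * z - x2 a * w + x3 a * z * w \<noteq> 0"
    if "cmod z < 1" "cmod w < 1" for z w
  proof
    assume "1 - x1 a * z - x2 a * w + x3 a * z * w = 0"
    then have "1 - x2 a * w = z * (x1 a - x3 a * w)"
      by (simp add: algebra_simps)
    then have "z * ((x1 a - x3 a * w) / (1 - x2 a * w)) = 1"
      using quotient_bound(1)[OF that(2) assms] by simp
    then have "cmod z * cmod ((x1 a - x3 a * w) / (1 - x2 a * w)) = 1"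
      by (metis norm_mult norm_one)
    then show False
      using mult_left_mono[OF quotient_bound(2)[OF that(2) assms], of "cmod z"] that(1) by simp
  qed
  define y where "y = (\<lambda>r::real. (r * x1 a, r * x2 a, r\<^sup>2 * x3 a) :: c3)"
  have inside: "y r \<in> tetrablock" if "0 < r" "r < 1" for r
  proof -
    have "1 - r * x1 a * z - r * x2 a * w + r\<^sup>2 * x3 a * z * w \<noteq> 0"
      if "cmod z \<le> 1" "cmod w \<le> 1" for z w
    proof -
      have shrink: "cmod (r * v) < 1" if "cmod v \<le> 1" for v :: complex
      proof -
        have "cmod (r * v) = r * cmod v"
          using \<open>0 < r\<close> by (simp add: norm_mult)
        also have "\<dots> \<le> r"
          using that \<open>0 < r\<close> by (intro mult_left_le) auto
        finally show ?thesis
          using \<open>r < 1\<close> by simp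
      qed
      from open_bidisc[OF shrink shrink, OF that] show ?thesis
        by (simp add: algebra_simps power2_eq_square)
    qed
    then show ?thesis
      by (simp add: y_def tetrablock_def)
  qed
  have "(y \<longlongrightarrow> y 1) (at_left 1)"
    unfolding y_def by (intro tendsto_intros)
  then have "(y \<longlongrightarrow> tetra_map a) (at_left 1)"
    by (simp add: y_def tetra_map_def)
  moreover have "\<forall>\<^sub>F r in at_left 1. y r \<in> closure tetrablock"
    using eventually_at_left_real[of 0 "1::real"] closure_subset[of tetrablock]
    by (auto elim!: eventually_mono dest: inside)
  ultimately show ?thesis
    by (intro Lim_in_closed_set[of "closure tetrablock" y "at_left 1"]) auto
qed

lemma rational_tetra_inner_tetra_map: "rational_tetra_inner tetra_map"
proof -
  have components: "(\<lambda>z. fst (tetra_map z)) = x1" "(\<lambda>z. fst (snd (tetra_map z))) = x2"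
    "(\<lambda>z. snd (snd (tetra_map z))) = x3"
    by (simp_all add: tetra_map_def)
  show ?thesis
    unfolding rational_tetra_inner_def components
  proof (intro conjI)
    show "\<forall>f\<in>{x1, x2, x3}. rational_on_disc f \<and> f holomorphic_on ball 0 1
        \<and> continuous_on (cball 0 1) f"
      using rational_components holomorphic_components continuous_components by blast
    show "tetra_map ` ball 0 1 \<subseteq> closure tetrablock"
      by (rule image_subsetI, rule tetra_map_closure) simp
    show "tetra_map ` sphere 0 1 \<subseteq> b_tetrablock"
      by (rule image_subsetI, rule tetra_map_circle) simp
  qed
qed

lemma tetra_representation_tetra_map:
  "tetra_representation n tetra_map E (conj_reflect n E) D"
  by (simp add: tetra_representation_def tetra_map_def component_defs degree_E degree_D
      degree_conj_reflect D_nonzero)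

text \<open>On the circle \<open>x3 = z\<^sup>n * cnj D / D\<close>, and \<open>D\<close> has no zeros in the closed disc, so it can be
  deformed through \<open>D (r * z)\<close> to a constant, while \<open>x1\<close> and \<open>x2\<close> are contracted to \<open>0\<close>.  The
  unimodular constant \<open>cnj (D 0) / D 0 = cis \<theta>\<close> that is left is turned back to \<open>1\<close>.\<close>

lemma homotopic_tetra_map:
  "homotopic_loops b_tetrablock (\<lambda>t. tetra_map (cis (2 * pi * t)))
     (\<lambda>t. (0, 0, cis (2 * pi * real n * t)))"
proof -
  have D0: "poly D 0 \<noteq> 0"
    using D_nonzero[of 0] by simp
  then have "cmod (cnj (poly D 0) / poly D 0) = 1"
    by (simp add: norm_divide)
  then obtain \<theta> where \<theta>: "cnj (poly D 0) / poly D 0 = cis \<theta>"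
    by (metis cis_Arg norm_eq_zero sgn_eq div_by_1 of_real_1 zero_neq_one)
  \<comment> \<open>\<open>y\<close> and \<open>u\<close> deform \<open>x2\<close> and \<open>x3\<close>; the boundary relation then dictates the first component
    of \<open>h\<close>\<close>
  define c where "c = (\<lambda>t::real. cis (2 * pi * t))"
  define u where "u = (\<lambda>(s, t). c t ^ n * (cnj (poly D ((1 - of_real s) * c t))
      / poly D ((1 - of_real s) * c t)) * cis (- (s * \<theta>)))"
  define y where "y = (\<lambda>(s, t). (1 - of_real s) * x2 (c t))"
  define h where "h = (\<lambda>p::real \<times> real. (cnj (y p) * u p, y p, u p))"
  have c: "cmod (c t) = 1" for t
    by (simp add: c_def)
  have nz: "poly D ((1 - of_real s) * c t) \<noteq> 0" if "s \<in> {0..1}" for s t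
  proof (rule D_nonzero)
    have "cmod (1 - of_real s) = 1 - s"
      using that by (metis abs_of_nonneg atLeastAtMost_iff diff_ge_0_iff_ge norm_of_real
          of_real_1 of_real_diff)
    then show "cmod ((1 - of_real s) * c t) \<le> 1"
      using that by (simp add: norm_mult c)
  qed
  have cont_c: "continuous_on UNIV c"
    unfolding c_def by (intro continuous_intros)
  have cont_x2: "continuous_on UNIV (\<lambda>t. x2 (c t))"
    by (rule continuous_on_compose2[OF continuous_components(2) cont_c]) (auto simp: c)
  have cont_u: "continuous_on ({0..1} \<times> {0..1}) u"
    unfolding u_def case_prod_unfold using nz
    by (intro continuous_intros continuous_on_compose2[OF cont_c]) auto
  have cont_y: "continuous_on ({0..1} \<times> {0..1}) y"
    unfolding y_def case_prod_unfold
    by (intro continuous_intros continuous_on_compose2[OF cont_x2]) auto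
  show ?thesis
    unfolding homotopic_loops
  proof (intro exI[of _ h] conjI ballI)
    show "continuous_on ({0..1} \<times> {0..1}) h"
      unfolding h_def by (intro continuous_intros cont_u cont_y)
    show "h \<in> {0..1} \<times> {0..1} \<rightarrow> b_tetrablock"
    proof
      fix p :: "real \<times> real" assume "p \<in> {0..1} \<times> {0..1}"
      then obtain s t where p: "p = (s, t)" "s \<in> {0..1}"
        by auto
      have "cmod (1 - of_real s) \<le> 1"
        using p(2) by (metis abs_of_nonneg atLeastAtMost_iff diff_ge_0_iff_ge norm_of_real
            of_real_1 of_real_diff diff_le_eq le_add_same_cancel1)
      then have "cmod (y p) \<le> 1"
        using norm_x2_circle[OF c[of t]] by (simp add: p y_def norm_mult mult_le_one)
      moreover have "cmod (u p) = 1"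
        using nz[OF p(2), of t] by (simp add: p u_def norm_mult norm_divide norm_power c)
      ultimately show "h p \<in> b_tetrablock"
        by (simp add: h_def b_tetrablock_def)
    qed
    fix t :: real
    have "u (0, t) = x3 (c t)" "y (0, t) = x2 (c t)"
      by (auto simp: u_def y_def x3_circle[OF c])
    then show "h (0, t) = tetra_map (cis (2 * pi * t))"
      using x1_eq_circle[OF c[of t]] by (simp add: h_def tetra_map_def c_def)
    have "u (1, t) = c t ^ n * (cnj (poly D 0) / poly D 0 * cis (- \<theta>))"
      by (simp add: u_def)
    also have "\<dots> = c t ^ n"
      unfolding \<theta> by (simp add: cis_mult)
    finally have "u (1, t) = c t ^ n" .
    then show "h (1, t) = (0, 0, cis (2 * pi * real n * t))"
      by (simp add: h_def y_def c_def Complex.DeMoivre mult_ac)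
    have "c 1 = c 0"
      by (simp add: c_def)
    then show "pathfinish (h \<circ> Pair t) = pathstart (h \<circ> Pair t)"
      by (simp add: pathfinish_def pathstart_def h_def u_def y_def)
  qed
qed

end

text \<open>The third coordinate maps the distinguished boundary into the punctured plane, where the
  winding number separates the generating loops.\<close>

lemma homotopic_generator_loops_imp_eq:
  fixes k l :: int
  assumes "homotopic_loops b_tetrablock (\<lambda>t. (0, 0, cis (2 * pi * of_int k * t)))
    (\<lambda>t. (0, 0, cis (2 * pi * of_int l * t)))"
  shows "k = l"
proof -
  have winding: "winding_number (\<lambda>t. cis (2 * pi * of_int m * t)) 0 = of_int m" for m
  proof -
    have "winding_number (exp \<circ> (\<lambda>t. of_real (2 * pi * of_int m * t) * \<i>)) 0 = of_int m"
      by (subst winding_number_compose_exp)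
        (auto simp: path_def pathfinish_def pathstart_def intro!: continuous_intros)
    then show ?thesis
      by (simp add: comp_def cis_conv_exp mult.commute)
  qed
  have "homotopic_loops (- {0}) (\<lambda>t. cis (2 * pi * of_int k * t))
      (\<lambda>t. cis (2 * pi * of_int l * t))"
    using homotopic_loops_continuous_image[OF assms, of "\<lambda>p. snd (snd p)" "- {0}"]
    by (fastforce simp: comp_def b_tetrablock_def intro!: continuous_intros)
  from winding_number_homotopic_loops[OF this] show ?thesis
    by (simp add: winding)
qed

lemma (in tetra_data) tetra_degree_tetra_map: "tetra_degree tetra_map = int n"
  unfolding tetra_degree_def
proof (rule the_equality)
  show "homotopic_loops b_tetrablock (\<lambda>t. tetra_map (cis (2 * pi * t)))
     (\<lambda>t. (0, 0, cis (2 * pi * of_int (int n) * t)))"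
    using homotopic_tetra_map by simp
  fix k assume "homotopic_loops b_tetrablock (\<lambda>t. tetra_map (cis (2 * pi * t)))
     (\<lambda>t. (0, 0, cis (2 * pi * of_int k * t)))"
  then show "k = int n"
    using homotopic_tetra_map
    by (intro homotopic_generator_loops_imp_eq)
      (auto intro: homotopic_loops_trans homotopic_loops_sym)
qed


section \<open>Royal polynomial and royal nodes\<close>

context tetra_data
begin

lemma tetra_map_royal_iff:
  assumes "cmod z \<le> 1"
  shows "tetra_map z \<in> royal_variety \<longleftrightarrow>
    poly (conj_reflect n D * D - E * conj_reflect n E) z = 0"
  using D_nonzero[OF assms]
  by (auto simp: tetra_map_def component_defs royal_variety_def field_simps)

lemma royal_polynomial_tetra_map:
  "royal_polynomial tetra_map (conj_reflect n D * D - E * conj_reflect n E)"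
  unfolding royal_polynomial_def
  using tetra_degree_tetra_map tetra_representation_tetra_map by blast

text \<open>Multiplicities determine the set of nodes: where \<open>D\<close> has no zeros, \<open>x1 * x2 = x3\<close> says that the
  royal polynomial vanishes.\<close>

lemma royal_nodes_tetra_map:
  assumes R: "R = conj_reflect n D * D - E * conj_reflect n E" and "R \<noteq> 0"
    and M: "set_mset M \<subseteq> cball 0 1"
    and mult: "\<And>z. cmod z \<le> 1 \<Longrightarrow> real (count M z) = royal_multiplicity R z"
  shows "royal_nodes tetra_map M"
  unfolding royal_nodes_def
proof (intro conjI exI[of _ R] ballI)
  show "\<not> tetra_map ` cball 0 1 \<subseteq> royal_variety"
  proof
    assume "tetra_map ` cball 0 1 \<subseteq> royal_variety"
    then have "tetra_map z \<in> royal_variety" if "cmod z = 1" for z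
      using that by (simp add: image_subset_iff)
    then have "poly R z = poly 0 z" if "cmod z = 1" for z
      using tetra_map_royal_iff[of z] that R by simp
    then show False
      using poly_eqI_circle \<open>R \<noteq> 0\<close> by blast
  qed
  have "z \<in># M \<longleftrightarrow> tetra_map z \<in> royal_variety" if "cmod z \<le> 1" for z
  proof -
    have "z \<in># M \<longleftrightarrow> royal_multiplicity R z \<noteq> 0"
      unfolding mult[OF that, symmetric] by simp
    also have "\<dots> \<longleftrightarrow> poly R z = 0"
      using \<open>R \<noteq> 0\<close> by (simp add: royal_multiplicity_def order_root)
    finally show ?thesis
      using tetra_map_royal_iff[OF that] R by simp
  qed
  then show "set_mset M = {\<sigma> \<in> cball 0 1. tetra_map \<sigma> \<in> royal_variety}"
    using M by auto
  show "royal_polynomial tetra_map R"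
    using royal_polynomial_tetra_map R by simp
qed (use mult in simp)

lemma zeros_in_cdisc_quotient:
  assumes "p \<noteq> 0" "set_mset M \<subseteq> cball 0 1"
    and "\<And>z. cmod z \<le> 1 \<Longrightarrow> count M z = order z p"
  shows "zeros_in_cdisc (\<lambda>z. poly p z / poly D z) M"
  unfolding zeros_in_cdisc_def
  using assms D_nonzero by (intro conjI exI[of _ p] exI[of _ D]) auto

end

section \<open>Solutions of the spectral equation\<close>

text \<open>That \<open>\<rho>\<close> and \<open>E\<close> have no common zero on the circle makes
  \<open>\<rho> + \<bar>E\<bar>\<^sup>2\<close> strictly positive, so that a spectral factor exists and does not vanish on the circle;
  \<open>\<rho> \<ge> 0\<close> then is the bound \<open>\<bar>E\<bar> \<le> \<bar>D\<bar>\<close>.\<close>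

locale spectral_problem =
  fixes n :: nat and R E :: "complex poly" and \<rho> :: "complex \<Rightarrow> real"
  assumes degree_R: "degree R \<le> 2 * n" and degree_E: "degree E \<le> n"
    and R_circle: "cmod z = 1 \<Longrightarrow> poly R z = of_real (\<rho> z) * z ^ n"
    and \<rho>_nonneg: "\<rho> z \<ge> 0"
    and no_common_zero: "cmod z = 1 \<Longrightarrow> \<rho> z = 0 \<Longrightarrow> poly E z \<noteq> 0"
begin

definition spectral :: "complex poly \<Rightarrow> bool" where
  "spectral D \<longleftrightarrow> outer_poly D \<and> degree D \<le> n \<and>
     (\<forall>z\<in>sphere 0 1. poly R z / z ^ n + of_real ((cmod (poly E z))\<^sup>2)
        = of_real ((cmod (poly D z))\<^sup>2))"

lemma positive: "cmod z = 1 \<Longrightarrow> \<rho> z + (cmod (poly E z))\<^sup>2 > 0"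
  using \<rho>_nonneg[of z] no_common_zero[of z]
  by (cases "\<rho> z = 0") (auto intro: add_pos_nonneg)

lemma spectral_iff:
  "spectral D \<longleftrightarrow> outer_poly D \<and> degree D \<le> n \<and>
     (\<forall>z. cmod z = 1 \<longrightarrow> (cmod (poly D z))\<^sup>2 = \<rho> z + (cmod (poly E z))\<^sup>2)"
proof -
  have "poly R z / z ^ n + of_real ((cmod (poly E z))\<^sup>2) = of_real ((cmod (poly D z))\<^sup>2)
      \<longleftrightarrow> (cmod (poly D z))\<^sup>2 = \<rho> z + (cmod (poly E z))\<^sup>2" if z: "cmod z = 1" for z
  proof -
    have "z \<noteq> 0"
      using z by auto
    then have "poly R z / z ^ n + of_real ((cmod (poly E z))\<^sup>2)
        = (of_real (\<rho> z + (cmod (poly E z))\<^sup>2) :: complex)"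
      by (simp add: R_circle[OF z])
    then show ?thesis
      by (metis of_real_eq_iff)
  qed
  then show ?thesis
    unfolding spectral_def Ball_def mem_sphere dist_0_norm by blast
qed

lemma spectral_exists: "\<exists>D. spectral D"
proof -
  define P where "P = R + E * conj_reflect n E"
  have P_circle: "poly P z = of_real (\<rho> z + (cmod (poly E z))\<^sup>2) * z ^ n" if z: "cmod z = 1" for z
    unfolding of_real_add complex_norm_square
    by (simp add: P_def R_circle[OF z] poly_conj_reflect_circle[OF degree_E z] algebra_simps)
  have "degree (E * conj_reflect n E) \<le> 2 * n"
    using degree_E degree_conj_reflect[of n E] by (intro order_trans[OF degree_mult_le]) auto
  then have "degree P \<le> 2 * n"
    unfolding P_def using degree_R by (intro degree_add_le)
  then obtain D where D: "degree D \<le> n" "outer_poly D"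
    "\<And>z. cmod z = 1 \<Longrightarrow> poly P z = of_real ((cmod (poly D z))\<^sup>2) * z ^ n"
    using fejer_riesz_positive[of P n] P_circle positive by blast
  have "(cmod (poly D z))\<^sup>2 = \<rho> z + (cmod (poly E z))\<^sup>2" if z: "cmod z = 1" for z
  proof -
    have "z ^ n \<noteq> 0"
      using z by auto
    then show ?thesis
      using P_circle[OF z] D(3)[OF z] by (metis mult_right_cancel of_real_eq_iff)
  qed
  then show ?thesis
    using D(1,2) spectral_iff by blast
qed

lemma spectral_royal:
  assumes "spectral D"
  shows "conj_reflect n D * D - E * conj_reflect n E = R"
proof (rule poly_eqI_circle)
  fix z :: complex assume z: "cmod z = 1"
  have D: "degree D \<le> n" "(cmod (poly D z))\<^sup>2 = \<rho> z + (cmod (poly E z))\<^sup>2"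
    using assms z by (auto simp: spectral_iff)
  have "poly (conj_reflect n D * D - E * conj_reflect n E) z
      = z ^ n * (of_real ((cmod (poly D z))\<^sup>2) - of_real ((cmod (poly E z))\<^sup>2))"
    unfolding complex_norm_square
    by (simp add: poly_conj_reflect_circle[OF degree_E z] poly_conj_reflect_circle[OF D(1) z]
        algebra_simps)
  also have "\<dots> = poly R z"
    by (simp add: D(2) R_circle[OF z])
  finally show "poly (conj_reflect n D * D - E * conj_reflect n E) z = poly R z" .
qed

lemma spectral_tetra_data:
  assumes "spectral D"
  shows "tetra_data n E D"
proof
  have D: "(cmod (poly D z))\<^sup>2 = \<rho> z + (cmod (poly E z))\<^sup>2" if "cmod z = 1" for z
    using assms that by (auto simp: spectral_iff)
  show "degree E \<le> n" "degree D \<le> n"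
    using degree_E assms by (auto simp: spectral_iff)
  show "poly D z \<noteq> 0" if "cmod z \<le> 1" for z
  proof (cases "cmod z = 1")
    case True
    then show ?thesis
      using D positive by fastforce
  next
    case False
    then show ?thesis
      using assms that by (auto simp: spectral_iff outer_poly_def)
  qed
  show "cmod (poly E z) \<le> cmod (poly D z)" if "cmod z = 1" for z
    using D[OF that] \<rho>_nonneg[of z] by (intro power2_le_imp_le[OF _ norm_ge_zero]) linarith
qed

end

section \<open>Existence with prescribed zeros and royal nodes\<close>

lemma spectral_problem_prescribed:
  fixes t_plus :: real
  assumes "k + l = n" "t_plus > 0" "t \<noteq> 0"
    and disjoint: "\<forall>j\<in>{1..n}. s j \<notin> (a ` {1..k} \<union> b ` {1..l}) \<inter> sphere 0 1"
  shows "spectral_problem n (smult (of_real t_plus) (\<Prod>j=1..n. [:- s j, 1:] * [:1, - cnj (s j):]))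
    (smult t ((\<Prod>j=1..k. [:- a j, 1:]) * (\<Prod>j=1..l. [:1, - cnj (b j):])))
    (\<lambda>z. t_plus * (\<Prod>j=1..n. (cmod (z - s j))\<^sup>2))"
    (is "spectral_problem n ?R ?E ?\<rho>")
proof
  show "degree ?E \<le> n"
    using degree_prod_linear[of t a k b l] assms(1) by simp
  show "degree ?R \<le> 2 * n"
    using degree_prod_linear[of "of_real t_plus" s n s n] by (simp only: prod.distrib mult_2)
  show "?\<rho> z \<ge> 0" for z
    using assms(2) by (intro mult_nonneg_nonneg prod_nonneg) auto
  fix z :: complex assume z: "cmod z = 1"
  have "(z - s j) * (1 - cnj (s j) * z) = of_real ((cmod (z - s j))\<^sup>2) * z" for j
    unfolding reflected_factor_on_circle(1)[OF z] complex_norm_square by simp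
  then have "(\<Prod>j=1..n. (z - s j) * (1 - cnj (s j) * z))
      = (\<Prod>j=1..n. of_real ((cmod (z - s j))\<^sup>2) * z)"
    by simp
  also have "\<dots> = of_real (\<Prod>j=1..n. (cmod (z - s j))\<^sup>2) * z ^ n"
    by (simp add: prod.distrib)
  finally show "poly ?R z = of_real (?\<rho> z) * z ^ n"
    by (simp add: poly_prod mult_ac del: mult_pCons_left mult_pCons_right)
  assume "?\<rho> z = 0"
  then obtain j where j: "j \<in> {1..n}" "z = s j"
    using assms(2) by auto
  show "poly ?E z \<noteq> 0"
  proof
    assume "poly ?E z = 0"
    then have "(\<exists>i\<in>{1..k}. z - a i = 0) \<or> (\<exists>i\<in>{1..l}. 1 - cnj (b i) * z = 0)"
      using assms(3) by (auto simp: poly_prod mult.commute)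
    then have "z \<in> a ` {1..k} \<union> b ` {1..l}"
      using z unfolding reflected_factor_on_circle(1)[OF z] by auto
    then show False
      using disjoint j z by auto
  qed
qed

lemma spectral_solution_properties:
  fixes t_plus :: real and n :: nat and E D :: "complex poly"
  defines "x \<equiv> \<lambda>z. (poly E z / poly D z, poly (conj_reflect n E) z / poly D z,
      poly (conj_reflect n D) z / poly D z)"
  assumes kl: "k + l = n" and t: "t_plus > 0" "t \<noteq> 0"
    and in_disc: "\<forall>j\<in>{1..k}. a j \<in> cball 0 1" "\<forall>j\<in>{1..l}. b j \<in> cball 0 1"
      "\<forall>j\<in>{1..n}. s j \<in> cball 0 1"
    and disjoint: "\<forall>j\<in>{1..n}. s j \<notin> (a ` {1..k} \<union> b ` {1..l}) \<inter> sphere 0 1"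
    and R: "R = smult (of_real t_plus) (\<Prod>j=1..n. [:- s j, 1:] * [:1, - cnj (s j):])"
    and E: "E = smult t ((\<Prod>j=1..k. [:- a j, 1:]) * (\<Prod>j=1..l. [:1, - cnj (b j):]))"
    and D: "outer_poly D" "degree D \<le> n"
      "\<forall>z\<in>sphere 0 1. poly R z / z ^ n + of_real ((cmod (poly E z))\<^sup>2)
        = of_real ((cmod (poly D z))\<^sup>2)"
  shows "rational_tetra_inner x"
    and "tetra_degree x = int n"
    and "zeros_in_cdisc (\<lambda>z. fst (x z)) (component_zeros (family k a) (family l b))"
    and "zeros_in_cdisc (\<lambda>z. fst (snd (x z))) (component_zeros (family l b) (family k a))"
    and "royal_nodes x (family n s)"
    and "tetra_representation n x E (conj_reflect n E) D"
    and "conj_reflect n D * D - E * conj_reflect n E = R"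
    and "royal_polynomial x R"
proof -
  have a: "\<And>j. j \<in> {1..k} \<Longrightarrow> cmod (a j) \<le> 1"
    and b: "\<And>j. j \<in> {1..l} \<Longrightarrow> cmod (b j) \<le> 1"
    and s: "\<And>j. j \<in> {1..n} \<Longrightarrow> cmod (s j) \<le> 1"
    using in_disc by auto
  interpret spectral_problem n R E "\<lambda>z. t_plus * (\<Prod>j=1..n. (cmod (z - s j))\<^sup>2)"
    unfolding R E using kl t disjoint by (rule spectral_problem_prescribed)
  have spectral: "spectral D"
    using D by (simp add: spectral_def)
  interpret tetra_data n E D
    using spectral by (rule spectral_tetra_data)
  have x_eq: "x = tetra_map"
    by (simp add: x_def tetra_map_def component_defs fun_eq_iff)
  have reflected: "conj_reflect n E
      = smult (cnj t) ((\<Prod>j=1..l. [:- b j, 1:]) * (\<Prod>j=1..k. [:1, - cnj (a j):]))"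
    unfolding E kl[symmetric] by (rule conj_reflect_prod_linear)
  show royal: "conj_reflect n D * D - E * conj_reflect n E = R"
    using spectral by (rule spectral_royal)
  show "rational_tetra_inner x" "tetra_degree x = int n"
    "tetra_representation n x E (conj_reflect n E) D"
    unfolding x_eq
    by (rule rational_tetra_inner_tetra_map tetra_degree_tetra_map tetra_representation_tetra_map)+
  show "royal_polynomial x R"
    unfolding x_eq royal[symmetric] by (rule royal_polynomial_tetra_map)
  have "E \<noteq> 0"
    using t(2) by (simp add: E)
  then show "zeros_in_cdisc (\<lambda>z. fst (x z)) (component_zeros (family k a) (family l b))"
    unfolding x_def fst_conv
    using set_component_zeros[of k a l b] order_prod_linear[of k a l b _ t] a b t(2)
    by (intro zeros_in_cdisc_quotient) (auto simp: E)
  have "conj_reflect n E \<noteq> 0"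
    using t(2) by (simp add: reflected)
  then show "zeros_in_cdisc (\<lambda>z. fst (snd (x z)))
      (component_zeros (family l b) (family k a))"
    unfolding x_def fst_conv snd_conv
    using set_component_zeros[of l b k a] order_prod_linear[of l b k a _ "cnj t"] a b t(2)
    by (intro zeros_in_cdisc_quotient) (auto simp: reflected)
  show "royal_nodes x (family n s)"
    unfolding x_eq
  proof (rule royal_nodes_tetra_map[OF royal[symmetric]])
    show "R \<noteq> 0"
      using t(1) by (simp add: R del: mult_pCons_left mult_pCons_right)
    show "set_mset (family n s) \<subseteq> cball 0 1"
      using s by (auto simp: set_mset_family)
    show "real (count (family n s) z) = royal_multiplicity R z" if "cmod z \<le> 1" for z
    proof -
      have "order z R = (if cmod z = 1 then 2 else 1) * count (family n s) z"
        unfolding R using s that t(1) by (intro order_royal) auto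
      then show ?thesis
        using that by (auto simp: royal_multiplicity_def)
    qed
  qed
qed

theorem theorem1p2:
  fixes n k1 k2 :: nat and \<alpha>1 \<alpha>2 \<sigma> :: "nat \<Rightarrow> complex"
  assumes "n > 0"
    and "k1 + k2 = n"
    and "\<forall>j\<in>{1..k1}. \<alpha>1 j \<in> cball 0 1"
    and "\<forall>j\<in>{1..k2}. \<alpha>2 j \<in> cball 0 1"
    and "\<forall>j\<in>{1..n}. \<sigma> j \<in> cball 0 1"
    and "\<forall>j\<in>{1..n}. \<sigma> j \<notin> (\<alpha>1 ` {1..k1} \<union> \<alpha>2 ` {1..k2}) \<inter> sphere 0 1"
  shows "(\<exists>x. rational_tetra_inner x \<and>
            zeros_in_cdisc (\<lambda>z. fst (x z)) (component_zeros (family k1 \<alpha>1) (family k2 \<alpha>2)) \<and>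
            zeros_in_cdisc (\<lambda>z. fst (snd (x z))) (component_zeros (family k2 \<alpha>2) (family k1 \<alpha>1)) \<and>
            royal_nodes x (family n \<sigma>)) \<and>
         (\<forall>(t_plus::real) (t::complex) R E1. t_plus > 0 \<longrightarrow> t \<noteq> 0 \<longrightarrow>
            R = smult (of_real t_plus) (\<Prod>j=1..n. [:- \<sigma> j, 1:] * [:1, - cnj (\<sigma> j):]) \<longrightarrow>
            E1 = smult t ((\<Prod>j=1..k1. [:- \<alpha>1 j, 1:]) * (\<Prod>j=1..k2. [:1, - cnj (\<alpha>2 j):])) \<longrightarrow>
            (let spectral = (\<lambda>D. outer_poly D \<and> degree D \<le> n \<and>
                   (\<forall>z\<in>sphere 0 1. poly R z / z ^ n + of_real ((cmod (poly E1 z))\<^sup>2)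
                      = of_real ((cmod (poly D z))\<^sup>2)))
             in (\<exists>D. spectral D) \<and>
                (\<forall>D x. spectral D \<longrightarrow>
                   x = (\<lambda>z. (poly E1 z / poly D z, poly (conj_reflect n E1) z / poly D z,
                             poly (conj_reflect n D) z / poly D z)) \<longrightarrow>
                   rational_tetra_inner x \<and>
                   tetra_degree x = int n \<and>
                   zeros_in_cdisc (\<lambda>z. fst (x z))
                     (component_zeros (family k1 \<alpha>1) (family k2 \<alpha>2)) \<and>
                   zeros_in_cdisc (\<lambda>z. fst (snd (x z)))
                     (component_zeros (family k2 \<alpha>2) (family k1 \<alpha>1)) \<and>
                   royal_nodes x (family n \<sigma>) \<and>
                   tetra_representation n x E1 (conj_reflect n E1) D \<and>
                   conj_reflect n D * D - E1 * conj_reflect n E1 = R \<and>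
                   royal_polynomial x R)))"
proof -
  let ?R = "\<lambda>t_plus::real. smult (of_real t_plus) (\<Prod>j=1..n. [:- \<sigma> j, 1:] * [:1, - cnj (\<sigma> j):])"
  let ?E = "\<lambda>t. smult t ((\<Prod>j=1..k1. [:- \<alpha>1 j, 1:]) * (\<Prod>j=1..k2. [:1, - cnj (\<alpha>2 j):]))"
  let ?spectral = "\<lambda>t_plus t D. outer_poly D \<and> degree D \<le> n \<and>
    (\<forall>z\<in>sphere 0 1. poly (?R t_plus) z / z ^ n + of_real ((cmod (poly (?E t) z))\<^sup>2)
      = of_real ((cmod (poly D z))\<^sup>2))"
  have spectral_exists: "\<exists>D. ?spectral t_plus t D" if "t_plus > 0" "t \<noteq> 0" for t_plus t
  proof -
    interpret spectral_problem n "?R t_plus" "?E t" "\<lambda>z. t_plus * (\<Prod>j=1..n. (cmod (z - \<sigma> j))\<^sup>2)"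
      using assms(2) that assms(6) by (rule spectral_problem_prescribed)
    show ?thesis
      using spectral_exists unfolding spectral_def .
  qed
  note properties =
    spectral_solution_properties[OF assms(2) _ _ assms(3-6) refl refl]
  \<comment> \<open>any choice of the two constants gives a function with the prescribed data\<close>
  obtain D where D: "?spectral 1 1 D"
    using spectral_exists[OF zero_less_one one_neq_zero] by blast
  note solution = properties[OF zero_less_one one_neq_zero
      D[THEN conjunct1] D[THEN conjunct2, THEN conjunct1] D[THEN conjunct2, THEN conjunct2]]
  show ?thesis
    unfolding Let_def
  proof (intro conjI allI impI)
    show "\<exists>x. rational_tetra_inner x \<and>
      zeros_in_cdisc (\<lambda>z. fst (x z)) (component_zeros (family k1 \<alpha>1) (family k2 \<alpha>2)) \<and>
      zeros_in_cdisc (\<lambda>z. fst (snd (x z))) (component_zeros (family k2 \<alpha>2) (family k1 \<alpha>1)) \<and>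
      royal_nodes x (family n \<sigma>)"
      by (rule exI, intro conjI) (rule solution(1) solution(3) solution(4) solution(5))+
    fix t_plus :: real and t :: complex and R E1
    assume t: "t_plus > 0" "t \<noteq> 0" and R: "R = ?R t_plus" and E1: "E1 = ?E t"
    show "\<exists>D. outer_poly D \<and> degree D \<le> n \<and>
      (\<forall>z\<in>sphere 0 1. poly R z / z ^ n + of_real ((cmod (poly E1 z))\<^sup>2)
        = of_real ((cmod (poly D z))\<^sup>2))"
      unfolding R E1 using t by (rule spectral_exists)
  qed (elim conjE; hypsubst; rule properties; assumption)+
qed

end
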